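(* Let $V:\mathcal{X}\to\mathbb{R}$ be a piecewise affine function, $V(x)=a_j^{\mathsf T}x+b_j$ for $x\in Y_j$, $j\in[N_c]$, so that $\nabla V=a_j$ on $\mathrm{int}(Y_j)$. Let $x\in\mathcal{X}\setminus\{0\}$ with $x\in\mathrm{int}(Y_j)$. If $\nabla V(x)^{\mathsf T}z<0$ for all $z\in\mathcal{F}_v(x)$, where $\mathcal{F}_v(x)$ is the set of vertices of the hyperbox $\mathbf{F}(x)$, then the Lyapunov decrease condition $\nabla V(x)^{\mathsf T}f(x)=a_j^{\mathsf T}f(x)<0$ holds.
   Context: Notation: $n,N_d,N_c$ are positive integers, $[m]=\{1,\dots,m\}$, $|\cdot|$ and inequalities between vectors are componentwise. Setting: $\mathcal{X}\subset\mathbb{R}^n$ is a convex compact polyhedral set; $f:\mathbb{R}^n\to\mathbb{R}^n$ satisfies $|f(x)-f(y)|\le M\|x-y\|_\infty$ for all $x,y\in\mathcal{X}$, with $M\in\mathbb{R}^n_{>0}$; a data set $\{(x_i,f_i)\}_{i\in[N_d]}$ with $x_i\in\mathcal{X}$, $f_i=f(x_i)$ is given. For $x\in\mathcal{X}$, let $\mathbf{F}(x)=\{z\in\mathbb{R}^n: |z-f_i|\le M\|x-x_i\|_\infty\ \forall i\in[N_d]\}$. This is a hyperbox $$\mathbf{F}(x)=[f_1^{\min}(x),f_1^{\max}(x)]\times\cdots\times[f_n^{\min}(x),f_n^{\max}(x)],$$ and its vertex set is $$\mathcal{F}_v(x)=\{z\in\mathbb{R}^n: z_k\in\{f_k^{\min}(x),f_k^{\max}(x)\}\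 \forall k\in[n]\}.$$ The cells $Y_1,\dots,Y_{N_c}$ are polyhedra with $\mathcal{X}=\bigcup_{j}Y_j$ and pairwise disjoint interiors; $a_j\in\mathbb{R}^n$, $b_j\in\mathbb{R}$. *)

theory Defs
  imports "HOL-Analysis.Analysis"
begin

(* Meaningful only where V is differentiable; otherwise the value is unspecified. *)
definition grad :: "('a::real_inner \<Rightarrow> real) \<Rightarrow> 'a \<Rightarrow> 'a" where
  "grad V x = (THE D. GDERIV V x :> D)"

lemma grad_eqI:
  assumes "GDERIV V x :> D"
  shows "grad V x = D"
  unfolding grad_def
proof (rule the_equality)
  show "GDERIV V x :> D" by fact
next
  fix E assume "GDERIV V x :> E"
  with assms have "(\<lambda>h. h \<bullet> D) = (\<lambda>h. h \<bullet> E)"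
    unfolding gderiv_def by (rule has_derivative_unique)
  then have "\<forall>h. h \<bullet> D = h \<bullet> E" by (simp add: fun_eq_iff)
  then have "(D - E) \<bullet> (D - E) = 0" by (simp add: inner_diff_right)
  then show "E = D" by simp
qed

definition hyperbox ::
    "nat \<Rightarrow> real^'n \<Rightarrow> (nat \<Rightarrow> real^'n) \<Rightarrow> (nat \<Rightarrow> real^'n) \<Rightarrow> real^'n \<Rightarrow> (real^'n) set" where
  "hyperbox N M xs fs x =
     {z. \<forall>i\<in>{1..N}. \<forall>k. \<bar>z $ k - fs i $ k\<bar> \<le> M $ k * infnorm (x - xs i)}"

(* The endpoints of the k-th side, read off from the set itself as the extreme values
   of the k-th coordinate. hyperbox_eq_cbox confirms that these are the endpoints. *)
definition fmin ::
    "nat \<Rightarrow> real^'n \<Rightarrow> (nat \<Rightarrow> real^'n) \<Rightarrow> (nat \<Rightarrow> real^'n) \<Rightarrow> real^'n \<Rightarrow> 'n \<Rightarrow> real" where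
  "fmin N M xs fs x k = Inf ((\<lambda>z. z $ k) ` hyperbox N M xs fs x)"

definition fmax ::
    "nat \<Rightarrow> real^'n \<Rightarrow> (nat \<Rightarrow> real^'n) \<Rightarrow> (nat \<Rightarrow> real^'n) \<Rightarrow> real^'n \<Rightarrow> 'n \<Rightarrow> real" where
  "fmax N M xs fs x k = Sup ((\<lambda>z. z $ k) ` hyperbox N M xs fs x)"

definition hyperbox_vertices ::
    "nat \<Rightarrow> real^'n \<Rightarrow> (nat \<Rightarrow> real^'n) \<Rightarrow> (nat \<Rightarrow> real^'n) \<Rightarrow> real^'n \<Rightarrow> (real^'n) set" where
  "hyperbox_vertices N M xs fs x =
     {z. \<forall>k. z $ k \<in> {fmin N M xs fs x k, fmax N M xs fs x k}}"

lemma hyperbox_eq_cbox: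
  fixes M :: "real^'n"
  assumes N: "0 < N" and ne: "hyperbox N M xs fs x \<noteq> {}"
  shows "hyperbox N M xs fs x = cbox (\<chi> k. fmin N M xs fs x k) (\<chi> k. fmax N M xs fs x k)"
    (is "?F = _")
proof -
  have bnd: "fs i $ k - M $ k * infnorm (x - xs i) \<le> z $ k"
            "z $ k \<le> fs i $ k + M $ k * infnorm (x - xs i)"
    if "z \<in> ?F" "i \<in> {1..N}" for z i k
  proof -
    have "\<bar>z $ k - fs i $ k\<bar> \<le> M $ k * infnorm (x - xs i)"
      using that by (simp add: hyperbox_def)
    then show "fs i $ k - M $ k * infnorm (x - xs i) \<le> z $ k"
      and "z $ k \<le> fs i $ k + M $ k * infnorm (x - xs i)"
      by linarith+
  qed
  have one: "1 \<in> {1..N}" using N by simp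
  have bb: "bdd_below ((\<lambda>z. z $ k) ` ?F)" for k
    using bnd(1)[OF _ one] by (intro bdd_belowI2)
  have ba: "bdd_above ((\<lambda>z. z $ k) ` ?F)" for k
    using bnd(2)[OF _ one] by (intro bdd_aboveI2)
  show ?thesis
  proof (intro equalityI subsetI)
    fix z assume "z \<in> ?F"
    then show "z \<in> cbox (\<chi> k. fmin N M xs fs x k) (\<chi> k. fmax N M xs fs x k)"
      by (simp add: mem_box_cart fmin_def fmax_def cInf_lower cSup_upper bb ba)
  next
    fix z assume z: "z \<in> cbox (\<chi> k. fmin N M xs fs x k) (\<chi> k. fmax N M xs fs x k)"
    have "\<bar>z $ k - fs i $ k\<bar> \<le> M $ k * infnorm (x - xs i)" if i: "i \<in> {1..N}" for i k
    proof -
      have "fs i $ k - M $ k * infnorm (x - xs i) \<le> fmin N M xs fs x k"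
        unfolding fmin_def using ne bnd(1)[OF _ i] by (intro cINF_greatest)
      moreover have "fmax N M xs fs x k \<le> fs i $ k + M $ k * infnorm (x - xs i)"
        unfolding fmax_def using ne bnd(2)[OF _ i] by (intro cSUP_least)
      moreover have "fmin N M xs fs x k \<le> z $ k" "z $ k \<le> fmax N M xs fs x k"
        using z by (simp_all add: mem_box_cart)
      ultimately show ?thesis by linarith
    qed
    then show "z \<in> ?F" by (simp add: hyperbox_def)
  qed
qed

end

theory Submission
  imports Defs
begin

text \<open>The linear functional \<open>z \<mapsto> g \<bullet> z\<close> attains its maximum over a box at the vertex
  that picks the upper endpoint in the coordinates where \<open>g\<close> is nonnegative and the lower one
  elsewhere. The Lipschitz bound puts \<open>f x\<close> into the box, so negativity at that vertex
  bounds \<open>g \<bullet> f x\<close>.\<close>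

text \<open>Differentiability at \<open>x\<close> depends only on values near \<open>x\<close>, so
  the derivative of the affine map carries over to \<open>V\<close> through the open set
  \<open>S\<close>.\<close>

lemma gderiv_affine_on_open:
  assumes "open S" "x \<in> S" and eq: "\<And>y. y \<in> S \<Longrightarrow> V y = a \<bullet> y + b"
  shows "GDERIV V x :> a"
proof -
  have "((\<lambda>y. a \<bullet> y + b) has_derivative (\<lambda>h. h \<bullet> a)) (at x)"
    by (auto intro!: derivative_eq_intros simp: inner_commute)
  then show ?thesis
    unfolding gderiv_def using assms
    by (elim has_derivative_transform_within_open) auto
qed

text \<open>The Lipschitz bound for the pair \<open>x\<close>, \<open>xs i\<close> is exactly the
  \<open>i\<close>-th constraint of the box.\<close>

lemma lipschitz_image_in_hyperbox:
  fixes f :: "real^'n \<Rightarrow> real^'n"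
  assumes "\<forall>x\<in>X. \<forall>y\<in>X. \<forall>k. \<bar>f x $ k - f y $ k\<bar> \<le> M $ k * infnorm (x - y)"
    and "\<forall>i\<in>{1..N}. xs i \<in> X \<and> fs i = f (xs i)"
    and "x \<in> X"
  shows "f x \<in> hyperbox N M xs fs x"
  using assms by (simp add: hyperbox_def)

lemma hyperbox_vertex_dominates:
  fixes g :: "real^'n"
  assumes "0 < N" and w: "w \<in> hyperbox N M xs fs x"
  obtains z where "z \<in> hyperbox_vertices N M xs fs x" "g \<bullet> w \<le> g \<bullet> z"
proof
  let ?l = "fmin N M xs fs x" and ?u = "fmax N M xs fs x"
  let ?z = "\<chi> k. if 0 \<le> g $ k then ?u k else ?l k"
  show "?z \<in> hyperbox_vertices N M xs fs x"
    by (simp add: hyperbox_vertices_def)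
  \<comment> \<open>The point \<open>w\<close> itself witnesses that the box is nonempty, as its
    description by endpoints requires.\<close>
  have "w \<in> cbox (\<chi> k. ?l k) (\<chi> k. ?u k)"
    using hyperbox_eq_cbox[of N M xs fs x] assms by blast
  then have "?l k \<le> w $ k" "w $ k \<le> ?u k" for k
    by (simp_all add: mem_box_cart)
  \<comment> \<open>A nonnegative \<open>g $ k\<close> preserves \<open>w $ k \<le> ?u k\<close>; a
    negative one reverses \<open>?l k \<le> w $ k\<close>.\<close>
  then have "g $ k * w $ k \<le> g $ k * ?z $ k" for k
    by (simp add: mult_left_mono mult_left_mono_neg)
  then show "g \<bullet> w \<le> g \<bullet> ?z"
    unfolding inner_vec_def by (intro sum_mono) simp
qed

theorem proposition3:
  fixes X :: "(real^'n) set"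
    and f :: "real^'n \<Rightarrow> real^'n"
    and M :: "real^'n"
    and Nd Nc :: nat
    and xs fs :: "nat \<Rightarrow> real^'n"
    and Y :: "nat \<Rightarrow> (real^'n) set"
    and a :: "nat \<Rightarrow> real^'n"
    and b :: "nat \<Rightarrow> real"
    and V :: "real^'n \<Rightarrow> real"
  assumes "0 < Nd" and "0 < Nc"
    and "convex X" and "compact X" and "polyhedron X"
    and "\<forall>k. 0 < M $ k"
    and "\<forall>x\<in>X. \<forall>y\<in>X. \<forall>k. \<bar>f x $ k - f y $ k\<bar> \<le> M $ k * infnorm (x - y)"
    and "\<forall>i\<in>{1..Nd}. xs i \<in> X \<and> fs i = f (xs i)"
    and "\<forall>j\<in>{1..Nc}. polyhedron (Y j)"
    and "X = (\<Union>j\<in>{1..Nc}. Y j)"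
    and "\<forall>i\<in>{1..Nc}. \<forall>j\<in>{1..Nc}. i \<noteq> j \<longrightarrow> interior (Y i) \<inter> interior (Y j) = {}"
    and "\<forall>j\<in>{1..Nc}. \<forall>x\<in>Y j. V x = a j \<bullet> x + b j"
  shows "(\<forall>j\<in>{1..Nc}. \<forall>x\<in>interior (Y j). GDERIV V x :> a j) \<and>
    (\<forall>j\<in>{1..Nc}. \<forall>x\<in>X - {0}. x \<in> interior (Y j) \<longrightarrow>
       (\<forall>z\<in>hyperbox_vertices Nd M xs fs x. grad V x \<bullet> z < 0) \<longrightarrow>
       grad V x \<bullet> f x = a j \<bullet> f x \<and> a j \<bullet> f x < 0)"
proof (intro conjI ballI impI)
  \<comment> \<open>\<open>V\<close> is known to be affine on \<open>Y j\<close>; the interior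
    supplies the open set needed to differentiate.\<close>
  show deriv: "GDERIV V x :> a j" if "j \<in> {1..Nc}" "x \<in> interior (Y j)" for j x
    using that assms(12) interior_subset
    by (intro gderiv_affine_on_open[OF open_interior]) blast+
  fix j x
  assume j: "j \<in> {1..Nc}" and xX: "x \<in> X - {0}" and x: "x \<in> interior (Y j)"
    and neg: "\<forall>z\<in>hyperbox_vertices Nd M xs fs x. grad V x \<bullet> z < 0"
  have "GDERIV V x :> a j"
    using j x by (rule deriv)
  \<comment> \<open>Uniqueness of the gradient resolves the definite description in
    \<open>grad\<close>, so \<open>neg\<close> becomes a statement about \<open>a j\<close>.\<close>
  then have g: "grad V x = a j"
    by (rule grad_eqI)
  then show "grad V x \<bullet> f x = a j \<bullet> f x"
    by simp
  have "f x \<in> hyperbox Nd M xs fs x"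
    using lipschitz_image_in_hyperbox[OF assms(7,8)] xX by simp
  then obtain z where "z \<in> hyperbox_vertices Nd M xs fs x" "a j \<bullet> f x \<le> a j \<bullet> z"
    using hyperbox_vertex_dominates[OF assms(1)] by blast
  with neg g show "a j \<bullet> f x < 0"
    by force
qed

end
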